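(* There exist universal constants $0<c\le C<\infty$ such that the following holds. Let $n,k\ge 1$ be integers and let $P,Q$ be probability measures on $[k]=\{1,\dots,k\}$. If $P\neq Q$, let $T>0$ be the unique solution of $$ \frac12\sum_{j=1}^k\sqrt{(P(j)+Q(j))^2+\frac{(P(j)-Q(j))^2}{T^2}}=e^{1/(2n)}, $$ and if $P=Q$, let $T=0$. Then $$ \mathrm{TV}\bigl(\operatorname{Mult}(n,P),\operatorname{Mult}(n,Q)\bigr)=\mathrm{TV}\bigl(P^{\otimes n},Q^{\otimes n}\bigr), $$ $$ c\,\min\{1,T\}\le \mathrm{TV}\bigl(\operatorname{Mult}(n,P),\operatorname{Mult}(n,Q)\bigr)\le C\,\min\{1,T\}, $$ and $c\,I\le T\le C\,I$, where $$ I:=\min_{A\subseteq[k]}\left\{ n\sum_{j\in A}|P(j)-Q(j)|+\sqrt{n\sum_{j\in A^c}\frac{(P(j)-Q(j))^2}{P(j)+Q(j)}}\right\}. $$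
   Context: For probability measures $\mu,\nu$ on a measurable space with $\sigma$-algebra $\mathcal F$, the total variation distance is $\mathrm{TV}(\mu,\nu):=\sup_{B\in\mathcal F}|\mu(B)-\nu(B)|$. $\operatorname{Mult}(n,P)$ denotes the law of the histogram of $n$ independent samples from $P$, i.e. of the vector of counts $(z_1,\dots,z_k)$ where $z_j$ is the number of samples equal to $j$. $P(j)$ denotes the mass $P(\{j\})$, $P^{\otimes n}$ is the $n$-fold product measure on $[k]^n$, $A^c=[k]\setminus A$, and $0/0:=0$. "Universal constants" means that $c,C$ do not depend on $n$, $k$, $P$, $Q$. *)

theory Defs
  imports "HOL-Probability.Probability"
begin

text \<open>Meaningful when the two measures have the same sigma-algebra, which is taken from the first.\<close>
definition TV :: "'a measure \<Rightarrow> 'a measure \<Rightarrow> real" where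
  "TV \<mu> \<nu> = (SUP B\<in>sets \<mu>. \<bar>measure \<mu> B - measure \<nu> B\<bar>)"

text \<open>Probability measures on \<open>{1..k}\<close> with the discrete sigma-algebra; then \<open>space P = {1..k}\<close>.\<close>
definition prob_on :: "nat \<Rightarrow> nat measure \<Rightarrow> bool" where
  "prob_on k P \<longleftrightarrow> prob_space P \<and> sets P = Pow {1..k}"

definition mass :: "nat measure \<Rightarrow> nat \<Rightarrow> real" where
  "mass P j = measure P {j}"

definition prod_law :: "nat \<Rightarrow> nat measure \<Rightarrow> (nat \<Rightarrow> nat) measure" where
  "prod_law n P = (\<Pi>\<^sub>M i\<in>{1..n}. P)"

definition histogram :: "nat \<Rightarrow> nat \<Rightarrow> (nat \<Rightarrow> nat) \<Rightarrow> (nat \<Rightarrow> nat)" where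
  "histogram n k x = (\<lambda>j\<in>{1..k}. card {i\<in>{1..n}. x i = j})"

definition Mult :: "nat \<Rightarrow> nat \<Rightarrow> nat measure \<Rightarrow> (nat \<Rightarrow> nat) measure" where
  "Mult n k P = distr (prod_law n P) (count_space ({1..k} \<rightarrow>\<^sub>E (UNIV :: nat set))) (histogram n k)"

definition solves_T :: "nat \<Rightarrow> nat \<Rightarrow> nat measure \<Rightarrow> nat measure \<Rightarrow> real \<Rightarrow> bool" where
  "solves_T n k P Q t \<longleftrightarrow> t > 0 \<and>
     (1/2) * (\<Sum>j=1..k. sqrt ((mass P j + mass Q j)\<^sup>2 + (mass P j - mass Q j)\<^sup>2 / t\<^sup>2))
       = exp (1 / (2 * real n))"

definition T_val :: "nat \<Rightarrow> nat \<Rightarrow> nat measure \<Rightarrow> nat measure \<Rightarrow> real" where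
  "T_val n k P Q = (if P = Q then 0 else (THE t. solves_T n k P Q t))"

text \<open>Division by zero yields 0 in HOL, in accordance with the convention \<open>0/0 = 0\<close>.\<close>
definition I_val :: "nat \<Rightarrow> nat \<Rightarrow> nat measure \<Rightarrow> nat measure \<Rightarrow> real" where
  "I_val n k P Q = Min ((\<lambda>A.
       real n * (\<Sum>j\<in>A. \<bar>mass P j - mass Q j\<bar>)
       + sqrt (real n * (\<Sum>j\<in>{1..k} - A. (mass P j - mass Q j)\<^sup>2 / (mass P j + mass Q j))))
     ` Pow {1..k})"

text \<open>\<open>distr\<close> is only the image law for measurable maps; \<open>histogram\<close> is one here.\<close>
lemma measurable_histogram:
  assumes "prob_on k P"
  shows "histogram n k \<in> prod_law n P \<rightarrow>\<^sub>M count_space ({1..k} \<rightarrow>\<^sub>E (UNIV :: nat set))"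
proof -
  have "sets P = sets (count_space {1..k})"
    using assms by (simp add: prob_on_def)
  hence "sets (prod_law n P) = sets (\<Pi>\<^sub>M i\<in>{1..n}. count_space {1..k})"
    unfolding prod_law_def by (intro sets_PiM_cong) auto
  also have "\<dots> = sets (count_space ({1..n} \<rightarrow>\<^sub>E {1..k}))"
    by (simp add: count_space_PiM_finite)
  finally have "sets (prod_law n P) = sets (count_space ({1..n} \<rightarrow>\<^sub>E {1..k}))" .
  moreover have "histogram n k \<in> count_space ({1..n} \<rightarrow>\<^sub>E {1..k})
      \<rightarrow>\<^sub>M count_space ({1..k} \<rightarrow>\<^sub>E (UNIV :: nat set))"
    by (auto simp: histogram_def)
  ultimately show ?thesis
    using measurable_cong_sets by blast
qed

end

theory Submission
  imports Defs "HOL-Complex_Analysis.Conformal_Mappings"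
begin

text \<open>
  Write \<open>m = (P + Q) / 2\<close> and \<open>r = (P - Q) / (P + Q)\<close>. Then \<open>P = m (1 + r)\<close>,
  \<open>Q = m (1 - r)\<close>, \<open>r\<close> has mean zero under the probability vector \<open>m\<close>, and the total variation
  distance of the product laws is half the sum over words \<open>x\<close> of the absolute value of
  \<open>f\<^sub>x(1) - f\<^sub>x(-1)\<close>, where \<open>f\<^sub>x(z)\<close> is the product of the factors
  \<open>m(x\<^sub>i) (1 + z r(x\<^sub>i))\<close>. The function \<open>huber y = y\<^sup>2 / sqrt (1 + y\<^sup>2)\<close> is
  comparable with \<open>min \<bar>y\<bar> y\<^sup>2\<close> and with \<open>sqrt (1 + y\<^sup>2) - 1\<close>, so the equation for \<open>T\<close>
  says, up to constants, that the mean of \<open>huber (r / T)\<close> under \<open>m\<close>, called \<open>energy (1 / T)\<close> below,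
  has order \<open>1 / n\<close> (\<open>energy_at_solution\<close>). Everything else is deduced from that.

  Upper bound (\<open>l1_dist_upper\<close>). The factors extend to complex \<open>z\<close>, and
  \<open>\<bar>1 + z r\<bar> \<le> 1 + Re z r + 2 huber (\<bar>z\<bar> r)\<close>. As \<open>r\<close> has mean zero, the linear term vanishes on
  average, so the L1 norm of \<open>f(z)\<close> is bounded by a constant on the whole disc \<open>\<bar>z\<bar> < 1 / T\<close>. The odd
  function \<open>f(z) - f(-z)\<close> vanishes at 0, and the Schwarz lemma on this disc yields a bound of order
  \<open>T\<close> at \<open>z = 1\<close>.

  Lower bound. For small \<open>T\<close> the test function is the imaginary part of the product of the unimodular
  numbers \<open>(1 + i l r(x\<^sub>i)) / \<bar>1 + i l r(x\<^sub>i)\<bar>\<close>, with \<open>l\<close> a small multiple of \<open>1 / T\<close>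
  (\<open>l1_dist_lower_riesz\<close>). The mean of that complex product under either product law is the \<open>n\<close>-th
  power of a number within \<open>O(1 / n)\<close> of 1, and the two bases differ by a number of order \<open>T / n\<close>
  whose imaginary part is at least its real part in size. When \<open>T\<close> is bounded below, the \<open>\<chi>\<^sup>2\<close>-like quantity \<open>n E r\<^sup>2\<close> is bounded below as well and the Hellinger
  affinity tensorises (\<open>l1_dist_lower_hellinger\<close>).

  Comparison with \<open>I\<close>. Bounding \<open>huber y\<close> by \<open>\<bar>y\<bar>\<close> on \<open>A\<close> and by \<open>y\<^sup>2\<close> off \<open>A\<close> gives \<open>T = O(I)\<close>,
  and these bounds are sharp up to a factor for \<open>A = {\<bar>r\<bar> > T}\<close>, which gives \<open>I = O(T)\<close>.

  Equality of the two distances. The mass of a word depends only on its histogram, so the set of words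
  on which the first product law is at least the second, which attains the supremum, is a preimage under
  the histogram map.
\<close>

section \<open>A smooth substitute for the smaller of the absolute value and the square\<close>

definition huber :: "real \<Rightarrow> real" where
  "huber y = y\<^sup>2 / sqrt (1 + y\<^sup>2)"

lemma huber_nonneg: "0 \<le> huber y"
  by (simp add: huber_def)

lemma huber_le_square: "huber y \<le> y\<^sup>2"
proof -
  have "1 \<le> sqrt (1 + y\<^sup>2)" by simp
  thus ?thesis unfolding huber_def
    by (metis divide_le_eq_1 div_by_1 frac_le order_refl zero_le_power2 zero_less_one)
qed

lemma abs_le_sqrt: "\<bar>y\<bar> \<le> sqrt (1 + y\<^sup>2)"
  by (rule real_le_rsqrt) simp

lemma sqrt_one_plus_pos: "0 < sqrt (1 + y\<^sup>2)" for y :: real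
  by (simp add: add_pos_nonneg)

lemma huber_le_abs: "huber y \<le> \<bar>y\<bar>"
proof -
  have "y\<^sup>2 = \<bar>y\<bar> * \<bar>y\<bar>" by (simp add: power2_eq_square)
  also have "\<dots> \<le> \<bar>y\<bar> * sqrt (1 + y\<^sup>2)" by (intro mult_left_mono abs_le_sqrt) auto
  finally show ?thesis using sqrt_one_plus_pos[of y] by (simp add: huber_def divide_le_eq)
qed

lemma square_le_huber:
  assumes "\<bar>y\<bar> \<le> 1"
  shows "y\<^sup>2 \<le> 2 * huber y"
proof -
  have "y\<^sup>2 \<le> 1" using assms by (simp add: abs_square_le_1)
  hence "sqrt (1 + y\<^sup>2) \<le> 2" by (intro real_le_lsqrt) auto
  hence "y\<^sup>2 * sqrt (1 + y\<^sup>2) \<le> y\<^sup>2 * 2" by (intro mult_left_mono) auto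
  thus ?thesis using sqrt_one_plus_pos[of y] by (simp add: huber_def field_simps)
qed

lemma abs_le_huber:
  assumes "1 \<le> \<bar>y\<bar>"
  shows "\<bar>y\<bar> \<le> 2 * huber y"
proof -
  have "1 \<le> y\<^sup>2" using assms by (metis one_le_power power2_abs)
  hence "sqrt (1 + y\<^sup>2) \<le> 2 * \<bar>y\<bar>" by (intro real_le_lsqrt) (auto simp: power_mult_distrib)
  hence "\<bar>y\<bar> * sqrt (1 + y\<^sup>2) \<le> \<bar>y\<bar> * (2 * \<bar>y\<bar>)" by (intro mult_left_mono) auto
  also have "\<dots> = 2 * y\<^sup>2" by (simp add: power2_eq_square)
  finally show ?thesis using sqrt_one_plus_pos[of y] by (simp add: huber_def field_simps)
qed

lemma huber_scale:
  assumes "0 \<le> a" "a \<le> 1"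
  shows "huber (a * y) \<le> a * huber y" "a\<^sup>2 * huber y \<le> huber (a * y)"
proof -
  have a2: "a\<^sup>2 \<le> 1" using assms by (simp add: power_le_one)
  have "a * sqrt (1 + y\<^sup>2) \<le> sqrt (1 + (a * y)\<^sup>2)"
    using assms a2 by (intro real_le_rsqrt) (simp add: power_mult_distrib algebra_simps)
  hence "(a * y\<^sup>2) * (a * sqrt (1 + y\<^sup>2)) \<le> (a * y\<^sup>2) * sqrt (1 + (a * y)\<^sup>2)"
    using assms by (intro mult_left_mono) auto
  thus "huber (a * y) \<le> a * huber y"
    using sqrt_one_plus_pos[of y] sqrt_one_plus_pos[of "a * y"]
    by (simp add: huber_def field_simps power2_eq_square)
  have "a\<^sup>2 * y\<^sup>2 \<le> 1 * y\<^sup>2" using a2 by (intro mult_right_mono) auto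
  hence "sqrt (1 + (a * y)\<^sup>2) \<le> sqrt (1 + y\<^sup>2)" by (simp add: power_mult_distrib)
  hence "(a * y)\<^sup>2 / sqrt (1 + y\<^sup>2) \<le> (a * y)\<^sup>2 / sqrt (1 + (a * y)\<^sup>2)"
    using sqrt_one_plus_pos[of "a * y"] by (intro divide_left_mono mult_pos_pos sqrt_one_plus_pos) auto
  thus "a\<^sup>2 * huber y \<le> huber (a * y)"
    by (simp add: huber_def power_mult_distrib)
qed

lemma huber_sqrt: "sqrt (1 + y\<^sup>2) - 1 \<le> huber y" "huber y \<le> 2 * (sqrt (1 + y\<^sup>2) - 1)"
proof -
  define s where "s = sqrt (1 + y\<^sup>2)"
  have s: "1 \<le> s" "y\<^sup>2 = s\<^sup>2 - 1" by (simp_all add: s_def)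
  have h: "huber y = (s\<^sup>2 - 1) / s" unfolding huber_def s_def[symmetric] unfolding s(2) ..
  have "s * (s - 1) \<le> s\<^sup>2 - 1" using s(1) by (simp add: power2_eq_square algebra_simps)
  thus "sqrt (1 + y\<^sup>2) - 1 \<le> huber y"
    using s(1) unfolding h s_def[symmetric] by (simp add: field_simps)
  have "0 \<le> (s - 1)\<^sup>2" by simp
  hence "s\<^sup>2 - 1 \<le> 2 * (s - 1) * s" by (simp add: power2_eq_square algebra_simps)
  thus "huber y \<le> 2 * (sqrt (1 + y\<^sup>2) - 1)"
    using s(1) unfolding h s_def[symmetric] by (simp add: divide_le_eq)
qed

text \<open>
  These control the error made on replacing \<open>y / sqrt (1 + y\<^sup>2)\<close> by \<open>y\<close>; mean-zero arguments need it
  because only the uncorrected \<open>y\<close> averages to zero.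
\<close>
lemma inverse_sqrt_defect:
  shows "\<bar>y\<bar> * (1 - 1 / sqrt (1 + y\<^sup>2)) \<le> huber y"
    and "1 - 1 / sqrt (1 + y\<^sup>2) \<le> huber y"
    and "0 \<le> 1 - 1 / sqrt (1 + y\<^sup>2)"
proof -
  define s where "s = sqrt (1 + y\<^sup>2)"
  have s: "1 \<le> s" "y\<^sup>2 = s\<^sup>2 - 1" by (simp_all add: s_def)
  have h: "huber y = y\<^sup>2 / s" unfolding huber_def s_def[symmetric] ..
  have d: "1 - 1 / s = (s - 1) / s" using s(1) by (simp add: field_simps)
  have "s \<le> 1 + \<bar>y\<bar>" unfolding s_def by (rule real_le_lsqrt) (auto simp: power2_eq_square algebra_simps)
  hence "\<bar>y\<bar> * (s - 1) \<le> \<bar>y\<bar> * \<bar>y\<bar>" by (intro mult_left_mono) auto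
  hence "\<bar>y\<bar> * (s - 1) \<le> y\<^sup>2" by (simp add: power2_eq_square)
  thus "\<bar>y\<bar> * (1 - 1 / sqrt (1 + y\<^sup>2)) \<le> huber y"
    using s(1) unfolding h s_def[symmetric] d by (simp add: divide_right_mono)
  have "1 * (s - 1) \<le> (s + 1) * (s - 1)" using s(1) by (intro mult_right_mono) auto
  hence "s - 1 \<le> y\<^sup>2" unfolding s(2) by (simp add: power2_eq_square algebra_simps)
  thus "1 - 1 / sqrt (1 + y\<^sup>2) \<le> huber y"
    using s(1) unfolding h s_def[symmetric] d by (simp add: divide_right_mono)
  show "0 \<le> 1 - 1 / sqrt (1 + y\<^sup>2)" using s(1) unfolding s_def[symmetric] by simp
qed

text \<open>
  The modulus grows only through \<open>Re z\<close> to first order; the remaining growth is controlled by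
  \<open>huber\<close>. Completing the square gives \<open>\<bar>1 + z t\<bar> \<le> s + x / s\<close> with \<open>s = sqrt (1 + (\<bar>z\<bar> t)\<^sup>2)\<close> and
  \<open>x = Re z t\<close>, and \<open>x / s\<close> is then replaced by \<open>x\<close>. Having exactly \<open>x\<close> matters, because this term
  averages to zero when \<open>t\<close> does.
\<close>
lemma norm_one_plus_le_huber:
  fixes z :: complex and t :: real
  shows "cmod (1 + z * of_real t) \<le> 1 + Re z * t + 2 * huber (cmod z * t)"
proof -
  define y where "y = cmod z * t"
  define s where "s = sqrt (1 + y\<^sup>2)"
  define x where "x = Re z * t"
  have s: "1 \<le> s" "s\<^sup>2 = 1 + y\<^sup>2" by (simp_all add: s_def)
  have xy: "\<bar>x\<bar> \<le> \<bar>y\<bar>" unfolding x_def y_def abs_mult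
    by (intro mult_right_mono) (auto simp: abs_Re_le_cmod)
  have "(cmod (1 + z * of_real t))\<^sup>2 = s\<^sup>2 + 2 * x"
    unfolding s(2) x_def y_def power_mult_distrib cmod_power2 by (simp add: power2_eq_square algebra_simps)
  also have "\<dots> \<le> (s + x / s)\<^sup>2" using s(1) by (simp add: power2_sum)
  finally have sq: "(cmod (1 + z * of_real t))\<^sup>2 \<le> (s + x / s)\<^sup>2" .
  have "0 \<le> s\<^sup>2 + x" using xy s(2) abs_le_sqrt[of y] sum_squares_ge_zero[of "\<bar>y\<bar> - 1/2" 0]
    by (simp add: power2_eq_square algebra_simps)
  hence "0 \<le> s + x / s" using s(1) by (simp add: field_simps power2_eq_square)
  hence "cmod (1 + z * of_real t) \<le> s + x / s" using sq by (rule power2_le_imp_le[rotated])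
  also have "\<dots> = s + x - x * (1 - 1 / s)" by (simp add: algebra_simps)
  also have "\<dots> \<le> s + x + \<bar>y\<bar> * (1 - 1 / s)"
  proof -
    have "- x * (1 - 1 / s) \<le> \<bar>y\<bar> * (1 - 1 / s)"
      using xy s(1) by (intro mult_right_mono) auto
    thus ?thesis by simp
  qed
  also have "\<dots> \<le> (1 + huber y) + x + huber y"
    using huber_sqrt(1)[of y] inverse_sqrt_defect(1)[of y] unfolding s_def by linarith
  finally show ?thesis by (simp add: x_def y_def)
qed

section \<open>Products over words\<close>

definition words :: "nat \<Rightarrow> 'a set \<Rightarrow> (nat \<Rightarrow> 'a) set" where
  "words n J = {1..n} \<rightarrow>\<^sub>E J"

lemma sum_words_prod:
  fixes f :: "'a \<Rightarrow> 'b::comm_semiring_1"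
  assumes "finite J"
  shows "(\<Sum>x\<in>words n J. \<Prod>i=1..n. f (x i)) = (\<Sum>j\<in>J. f j) ^ n"
  unfolding words_def using assms by (subst prod_sum_PiE[symmetric]) auto

lemma norm_power_mult_power_minus_one:
  fixes z w :: complex
  assumes "norm z \<le> 1" "norm w \<le> 1" "norm (z - 1) \<le> e" "norm (w - 1) \<le> e"
  shows "norm (z ^ a * w ^ b - 1) \<le> real (a + b) * e"
proof -
  have "z ^ a * w ^ b - 1 = (z ^ a - 1) * w ^ b + (w ^ b - 1)" by (simp add: algebra_simps)
  also have "norm \<dots> \<le> norm (z ^ a - 1) * norm (w ^ b) + norm (w ^ b - 1)"
    by (metis norm_mult norm_triangle_ineq)
  also have "\<dots> \<le> norm (z ^ a - 1) * 1 + norm (w ^ b - 1)"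
    using assms(2) by (intro add_mono mult_left_mono) (auto simp: norm_power power_le_one)
  also have "\<dots> \<le> real a * norm (z - 1) + real b * norm (w - 1)"
    using norm_power_diff[OF assms(1), of 1 a] norm_power_diff[OF assms(2), of 1 b] by simp
  also have "\<dots> \<le> real a * e + real b * e"
    using assms by (intro add_mono mult_left_mono) auto
  finally show ?thesis by (simp add: algebra_simps)
qed

lemma sqrt_prod: "sqrt (\<Prod>i\<in>A. f i) = (\<Prod>i\<in>A. sqrt (f i))"
  by (induction A rule: infinite_finite_induct) (auto simp: real_sqrt_mult)

lemma mult_le_abs:
  fixes d y :: real
  assumes "\<bar>y\<bar> \<le> 1"
  shows "d * y \<le> \<bar>d\<bar>"
proof -
  have "d * y \<le> \<bar>d\<bar> * \<bar>y\<bar>" unfolding abs_mult[symmetric] by (rule abs_ge_self)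
  also have "\<dots> \<le> \<bar>d\<bar> * 1" using assms by (intro mult_left_mono) auto
  finally show ?thesis by simp
qed

section \<open>Tilting a probability vector in opposite directions\<close>

text \<open>
  The pair of laws \<open>m (1 + r)\<close> and \<open>m (1 - r)\<close>: every pair of probability vectors has this form, with
  \<open>m\<close> their average.
\<close>
locale balanced_tilt =
  fixes J :: "'a set" and m r :: "'a \<Rightarrow> real"
  assumes finite_J: "finite J"
    and m_nonneg: "j \<in> J \<Longrightarrow> 0 \<le> m j"
    and sum_m: "(\<Sum>j\<in>J. m j) = 1"
    and sum_m_r: "(\<Sum>j\<in>J. m j * r j) = 0"
    and abs_r_le: "j \<in> J \<Longrightarrow> \<bar>r j\<bar> \<le> 1"
begin

definition tilt :: "real \<Rightarrow> 'a \<Rightarrow> real" where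
  "tilt t j = m j * (1 + t * r j)"

definition energy :: "real \<Rightarrow> real" where
  "energy \<rho> = (\<Sum>j\<in>J. m j * huber (\<rho> * r j))"

definition l1_dist :: "nat \<Rightarrow> real" where
  "l1_dist n = (\<Sum>x\<in>words n J. \<bar>(\<Prod>i=1..n. tilt 1 (x i)) - (\<Prod>i=1..n. tilt (-1) (x i))\<bar>)"

lemma energy_nonneg: "0 \<le> energy \<rho>"
  unfolding energy_def by (intro sum_nonneg mult_nonneg_nonneg m_nonneg huber_nonneg)

lemma energy_scale:
  assumes "0 \<le> a" "a \<le> 1"
  shows "energy (a * \<rho>) \<le> a * energy \<rho>" "a\<^sup>2 * energy \<rho> \<le> energy (a * \<rho>)"
proof -
  have "m j * huber (a * \<rho> * r j) \<le> a * (m j * huber (\<rho> * r j))"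
    and "a\<^sup>2 * (m j * huber (\<rho> * r j)) \<le> m j * huber (a * \<rho> * r j)" if "j \<in> J" for j
    using mult_left_mono[OF huber_scale(1)[OF assms, of "\<rho> * r j"] m_nonneg[OF that]]
      mult_left_mono[OF huber_scale(2)[OF assms, of "\<rho> * r j"] m_nonneg[OF that]]
    by (simp_all add: mult_ac)
  thus "energy (a * \<rho>) \<le> a * energy \<rho>" "a\<^sup>2 * energy \<rho> \<le> energy (a * \<rho>)"
    unfolding energy_def sum_distrib_left by (auto intro!: sum_mono)
qed

lemma tilt_nonneg: "j \<in> J \<Longrightarrow> \<bar>t\<bar> \<le> 1 \<Longrightarrow> 0 \<le> tilt t j"
proof -
  assume j: "j \<in> J" and t: "\<bar>t\<bar> \<le> 1"
  have "\<bar>t * r j\<bar> \<le> 1" unfolding abs_mult using abs_r_le[OF j] t by (intro mult_le_one) auto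
  thus ?thesis unfolding tilt_def using m_nonneg[OF j] by (intro mult_nonneg_nonneg) auto
qed

lemma sum_tilt: "(\<Sum>j\<in>J. tilt t j) = 1"
proof -
  have "(\<Sum>j\<in>J. tilt t j) = (\<Sum>j\<in>J. m j) + t * (\<Sum>j\<in>J. m j * r j)"
    by (simp add: tilt_def sum.distrib sum_distrib_left algebra_simps)
  thus ?thesis by (simp add: sum_m sum_m_r)
qed

lemma sum_words_tilt: "(\<Sum>x\<in>words n J. \<Prod>i=1..n. tilt t (x i)) = 1"
  by (subst sum_words_prod[OF finite_J]) (simp add: sum_tilt)

lemma words_mem: "x \<in> words n J \<Longrightarrow> i \<in> {1..n} \<Longrightarrow> x i \<in> J"
  by (auto simp: words_def)

text \<open>
  The L1 norm of the complex tilted product is the \<open>n\<close>-th power of a one-letter mean, and in that mean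
  the term linear in \<open>r\<close> cancels; this is why the bound depends on \<open>energy\<close> and not on the
  possibly much larger mean of \<open>\<bar>z r\<bar>\<close>.
\<close>
lemma norm_sum_complex_tilt_le:
  fixes g :: "(nat \<Rightarrow> 'a) \<Rightarrow> real"
  assumes g: "\<And>x. \<bar>g x\<bar> \<le> 1"
  shows "norm (\<Sum>x\<in>words n J. of_real (g x) * (\<Prod>i=1..n. of_real (m (x i)) * (1 + z * of_real (r (x i)))) :: complex)
           \<le> exp (2 * (real n * energy (norm z)))"
proof -
  let ?f = "\<lambda>j. m j * norm (1 + z * of_real (r j))"
  have "norm (\<Sum>x\<in>words n J. of_real (g x) * (\<Prod>i=1..n. of_real (m (x i)) * (1 + z * of_real (r (x i)))))
      \<le> (\<Sum>x\<in>words n J. \<Prod>i=1..n. ?f (x i))"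
  proof (rule sum_norm_le)
    fix x assume x: "x \<in> words n J"
    have "norm (\<Prod>i=1..n. of_real (m (x i)) * (1 + z * of_real (r (x i)))) = (\<Prod>i=1..n. ?f (x i))"
      unfolding prod_norm[symmetric]
      using m_nonneg[OF words_mem[OF x]] by (intro prod.cong refl) (simp add: norm_mult)
    moreover have "0 \<le> (\<Prod>i=1..n. ?f (x i))"
      using m_nonneg[OF words_mem[OF x]] by (intro prod_nonneg) auto
    ultimately show "norm (of_real (g x) * (\<Prod>i=1..n. of_real (m (x i)) * (1 + z * of_real (r (x i)))))
        \<le> (\<Prod>i=1..n. ?f (x i))"
      using mult_right_mono[OF g[of x]] by (simp add: norm_mult)
  qed
  also have "\<dots> = (\<Sum>j\<in>J. ?f j) ^ n" by (rule sum_words_prod[OF finite_J])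
  also have "\<dots> \<le> (exp (2 * energy (norm z))) ^ n"
  proof (rule power_mono)
    have "(\<Sum>j\<in>J. ?f j) \<le> (\<Sum>j\<in>J. m j * (1 + Re z * r j + 2 * huber (norm z * r j)))"
      by (intro sum_mono mult_left_mono norm_one_plus_le_huber m_nonneg)
    also have "\<dots> = (\<Sum>j\<in>J. tilt (Re z) j) + 2 * energy (norm z)"
      by (simp add: tilt_def energy_def sum.distrib sum_distrib_left algebra_simps)
    also have "\<dots> \<le> exp (2 * energy (norm z))" unfolding sum_tilt by (rule exp_ge_add_one_self)
    finally show "(\<Sum>j\<in>J. ?f j) \<le> exp (2 * energy (norm z))" .
    show "0 \<le> (\<Sum>j\<in>J. ?f j)" using m_nonneg by (intro sum_nonneg) auto
  qed
  also have "\<dots> = exp (2 * (real n * energy (norm z)))"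
    by (simp add: exp_of_nat_mult[symmetric] mult_ac)
  finally show ?thesis .
qed

text \<open>
  By duality against the sign \<open>g\<close> the distance is the value at \<open>z = 1\<close> of a scalar polynomial that is
  odd in \<open>z\<close>. It is at most \<open>2 exp 4\<close> on the disc of radius \<open>\<rho>\<close>, and the Schwarz lemma gains the
  factor \<open>1 / \<rho>\<close>.
\<close>
lemma l1_dist_upper:
  assumes \<rho>: "1 < \<rho>" and E: "real n * energy \<rho> \<le> 2"
  shows "l1_dist n \<le> 4 * exp 4 / \<rho>"
proof -
  define g where "g x = sgn ((\<Prod>i=1..n. tilt 1 (x i)) - (\<Prod>i=1..n. tilt (-1) (x i)))" for x
  define G where "G z = (\<Sum>x\<in>words n J. of_real (g x) * (\<Prod>i=1..n. of_real (m (x i)) * (1 + z * of_real (r (x i)))))"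
    for z :: complex
  \<comment> \<open>Dividing by twice the bound \<open>2 exp 4\<close> makes the inequality in the Schwarz lemma strict.\<close>
  define F where "F \<zeta> = (G (of_real \<rho> * \<zeta>) - G (- (of_real \<rho> * \<zeta>))) / of_real (4 * exp 4)" for \<zeta>
  have G_le: "norm (G z) \<le> exp 4" if "norm z < \<rho>" for z
  proof -
    have "norm (G z) \<le> exp (2 * (real n * energy (norm z)))"
      unfolding G_def by (rule norm_sum_complex_tilt_le) (simp add: g_def sgn_if)
    also have "energy (norm z) \<le> energy \<rho>"
    proof -
      have "energy ((norm z / \<rho>) * \<rho>) \<le> (norm z / \<rho>) * energy \<rho>"
        using that \<rho> by (intro energy_scale) auto
      also have "\<dots> \<le> 1 * energy \<rho>"
        using that \<rho> by (intro mult_right_mono energy_nonneg) auto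
      finally show ?thesis using \<rho> by simp
    qed
    hence "exp (2 * (real n * energy (norm z))) \<le> exp (2 * (real n * energy \<rho>))"
      by (simp add: mult_left_mono)
    also have "\<dots> \<le> exp 4" using E by simp
    finally show ?thesis .
  qed
  have "norm (F (1 / of_real \<rho>)) \<le> norm (1 / of_real \<rho> :: complex)"
  proof (rule Schwarz_Lemma(1))
    show "F holomorphic_on ball 0 1" unfolding F_def G_def by (intro holomorphic_intros) auto
    show "F 0 = 0" by (simp add: F_def)
    show "norm (F z) < 1" if "norm z < 1" for z
    proof -
      have z: "norm (of_real \<rho> * z) < \<rho>" using that \<rho> by (simp add: norm_mult)
      have "norm (G (of_real \<rho> * z) - G (- (of_real \<rho> * z))) \<le> exp 4 + exp 4"
        by (rule order_trans[OF norm_triangle_ineq4 add_mono]) (use z in \<open>auto intro!: G_le\<close>)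
      also have "\<dots> < 4 * exp 4" by simp
      finally show ?thesis by (simp add: F_def norm_divide)
    qed
    show "norm (1 / of_real \<rho> :: complex) < 1" using \<rho> by (simp add: norm_divide)
  qed
  moreover have "G 1 - G (-1) = of_real (l1_dist n)"
  proof -
    have "G (of_real t) = of_real (\<Sum>x\<in>words n J. g x * (\<Prod>i=1..n. tilt t (x i)))" for t
      by (simp add: G_def tilt_def)
    from this[of 1] this[of "-1"] have "G 1 - G (-1) =
        of_real (\<Sum>x\<in>words n J. g x * ((\<Prod>i=1..n. tilt 1 (x i)) - (\<Prod>i=1..n. tilt (-1) (x i))))"
      by (simp add: sum_subtractf right_diff_distrib)
    also have "\<dots> = of_real (l1_dist n)"
      unfolding l1_dist_def g_def by (intro arg_cong[of _ _ of_real] sum.cong refl) (simp add: sgn_if)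
    finally show ?thesis .
  qed
  moreover have "0 \<le> l1_dist n" unfolding l1_dist_def by (intro sum_nonneg) auto
  ultimately have "l1_dist n / (4 * exp 4) \<le> 1 / \<rho>"
    using \<rho> by (simp add: F_def norm_divide norm_mult)
  thus ?thesis using \<rho> by (simp add: field_simps)
qed

text \<open>
  The overlap of two laws is at most their Hellinger affinity, which is multiplicative over the letters
  of a word; per letter it is the mean of \<open>sqrt (1 - r\<^sup>2) \<le> 1 - r\<^sup>2 / 2\<close>.
\<close>
lemma l1_dist_lower_hellinger:
  "2 * (1 - exp (- real n * (\<Sum>j\<in>J. m j * (r j)\<^sup>2) / 2)) \<le> l1_dist n"
proof -
  let ?p = "\<lambda>x. \<Prod>i=1..n. tilt 1 (x i)" and ?q = "\<lambda>x. \<Prod>i=1..n. tilt (-1) (x i)"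
  let ?h = "\<lambda>j. sqrt (tilt 1 j * tilt (-1) j)"
  define v where "v = (\<Sum>j\<in>J. m j * (r j)\<^sup>2)"
  have h: "0 \<le> ?h j \<and> ?h j \<le> m j * (1 - (r j)\<^sup>2 / 2)" if j: "j \<in> J" for j
  proof
    show "0 \<le> ?h j" using tilt_nonneg[OF j] by auto
    have r1: "(r j)\<^sup>2 \<le> 1" using abs_r_le[OF j] by (simp add: abs_square_le_1)
    have "tilt 1 j * tilt (-1) j \<le> (m j * (1 - (r j)\<^sup>2 / 2))\<^sup>2"
    proof -
      have "tilt 1 j * tilt (-1) j = (m j)\<^sup>2 * (1 - (r j)\<^sup>2)"
        by (simp add: tilt_def power2_eq_square algebra_simps)
      also have "\<dots> \<le> (m j)\<^sup>2 * (1 - (r j)\<^sup>2 / 2)\<^sup>2"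
      proof (rule mult_left_mono)
        have "(1 - (r j)\<^sup>2 / 2)\<^sup>2 = 1 - (r j)\<^sup>2 + ((r j)\<^sup>2 / 2)\<^sup>2" by (simp add: power2_diff)
        thus "1 - (r j)\<^sup>2 \<le> (1 - (r j)\<^sup>2 / 2)\<^sup>2" by simp
      qed simp
      finally show ?thesis by (simp add: power_mult_distrib)
    qed
    thus "?h j \<le> m j * (1 - (r j)\<^sup>2 / 2)"
      using m_nonneg[OF j] r1 by (intro real_le_lsqrt mult_nonneg_nonneg) auto
  qed
  have "(\<Sum>x\<in>words n J. \<Prod>i=1..n. ?h (x i)) = (\<Sum>j\<in>J. ?h j) ^ n"
    by (rule sum_words_prod[OF finite_J])
  also have "\<dots> \<le> (exp (- v / 2)) ^ n"
  proof (rule power_mono)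
    have "(\<Sum>j\<in>J. ?h j) \<le> (\<Sum>j\<in>J. m j * (1 - (r j)\<^sup>2 / 2))" using h by (intro sum_mono) auto
    also have "\<dots> = 1 + (- v / 2)"
      by (simp add: v_def right_diff_distrib sum_subtractf sum_m sum_divide_distrib)
    also have "\<dots> \<le> exp (- v / 2)" by (rule exp_ge_add_one_self)
    finally show "(\<Sum>j\<in>J. ?h j) \<le> exp (- v / 2)" .
    show "0 \<le> (\<Sum>j\<in>J. ?h j)" using h by (intro sum_nonneg) auto
  qed
  also have "\<dots> = exp (- real n * v / 2)" by (simp add: exp_of_nat_mult[symmetric])
  finally have H: "(\<Sum>x\<in>words n J. \<Prod>i=1..n. ?h (x i)) \<le> exp (- real n * v / 2)" .
  have "2 - 2 * (\<Sum>x\<in>words n J. \<Prod>i=1..n. ?h (x i))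
      = (\<Sum>x\<in>words n J. ?p x + ?q x - 2 * (\<Prod>i=1..n. ?h (x i)))"
    unfolding sum_subtractf sum.distrib sum_words_tilt sum_distrib_left[symmetric] by simp
  also have "\<dots> \<le> l1_dist n" unfolding l1_dist_def
  proof (rule sum_mono)
    fix x assume x: "x \<in> words n J"
    have pq: "0 \<le> ?p x" "0 \<le> ?q x" using tilt_nonneg[OF words_mem[OF x]] by (auto intro!: prod_nonneg)
    have "(\<Prod>i=1..n. ?h (x i)) = sqrt (?p x * ?q x)"
      unfolding sqrt_prod[symmetric] prod.distrib ..
    moreover have "min (?p x) (?q x) \<le> sqrt (?p x * ?q x)"
    proof (rule real_le_rsqrt)
      show "(min (?p x) (?q x))\<^sup>2 \<le> ?p x * ?q x"
        unfolding power2_eq_square using pq by (intro mult_mono) auto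
    qed
    ultimately show "?p x + ?q x - 2 * (\<Prod>i=1..n. ?h (x i)) \<le> \<bar>?p x - ?q x\<bar>" by linarith
  qed
  finally show ?thesis using H unfolding v_def right_diff_distrib by linarith
qed

text \<open>
  A Riesz-product test. With \<open>u = (1 + i l r) / \<bar>1 + i l r\<bar>\<close>, let \<open>a\<close> and \<open>b\<close> be the means of \<open>u\<close> and
  \<open>r u\<close> under \<open>m\<close>, so that the product of the \<open>u(x\<^sub>i)\<close> has mean \<open>(a + b)\<^sup>n\<close> under one law of words
  and \<open>(a - b)\<^sup>n\<close> under the other. Since \<open>r\<close> has mean zero, both \<open>a + b\<close> and \<open>a - b\<close> lie within
  \<open>4 energy l \<le> 1 / (4 n)\<close> of 1, hence the powers do not rotate and their difference is \<open>2 n b\<close> up to a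
  relative error of one quarter. The imaginary part of \<open>b\<close> is \<open>energy l / l\<close> and dominates its real
  part, so that the imaginary part of the difference survives.
\<close>
lemma l1_dist_lower_riesz:
  assumes l: "1 \<le> l" and E: "16 * (real n * energy l) \<le> 1"
  shows "real n * energy l / l \<le> l1_dist n"
proof (cases n)
  case 0
  have "0 \<le> l1_dist n" unfolding l1_dist_def by (intro sum_nonneg) auto
  with 0 show ?thesis by simp
next
  case (Suc n')
  define s where "s j = sqrt (1 + (l * r j)\<^sup>2)" for j
  define u where "u j = Complex (1 / s j) (l * r j / s j)" for j
  define a where "a = (\<Sum>j\<in>J. of_real (m j) * u j)"
  define b where "b = (\<Sum>j\<in>J. of_real (m j * r j) * u j)"
  have s: "0 < s j" "(s j)\<^sup>2 = 1 + (l * r j)\<^sup>2" for j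
    using sqrt_one_plus_pos[of "l * r j"] by (simp_all add: s_def)
  have norm_u: "norm (u j) = 1" for j
  proof -
    have "(norm (u j))\<^sup>2 = (1 + (l * r j)\<^sup>2) / (s j)\<^sup>2"
      by (simp add: u_def cmod_power2 power_divide add_divide_distrib)
    also have "\<dots> = 1" unfolding s(2)[symmetric] using s(1)[of j] by simp
    finally show ?thesis using norm_ge_zero[of "u j"] by (auto simp: power2_eq_1_iff simp del: norm_ge_zero)
  qed
  have Im_b: "Im b = energy l / l"
    unfolding b_def energy_def sum_divide_distrib Im_sum
    using l by (intro sum.cong refl) (simp add: u_def huber_def s_def power2_eq_square)
  have Re_b: "Re b = - (\<Sum>j\<in>J. m j * (r j * (1 - 1 / s j)))"
  proof -
    have "Re b = (\<Sum>j\<in>J. m j * r j) - (\<Sum>j\<in>J. m j * (r j * (1 - 1 / s j)))"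
      unfolding sum_subtractf[symmetric] b_def Re_sum
      by (intro sum.cong refl) (simp add: u_def algebra_simps)
    thus ?thesis by (simp add: sum_m_r)
  qed
  have abs_Re_b: "\<bar>Re b\<bar> \<le> energy l / l"
  proof -
    have "\<bar>Re b\<bar> \<le> (\<Sum>j\<in>J. \<bar>m j * (r j * (1 - 1 / s j))\<bar>)" unfolding Re_b abs_minus by (rule sum_abs)
    also have "\<dots> \<le> (\<Sum>j\<in>J. m j * huber (l * r j) / l)"
    proof (rule sum_mono)
      fix j assume j: "j \<in> J"
      have "\<bar>l * r j\<bar> * (1 - 1 / s j) / l \<le> huber (l * r j) / l"
        using inverse_sqrt_defect(1)[of "l * r j"] l unfolding s_def by (intro divide_right_mono) auto
      hence "\<bar>r j * (1 - 1 / s j)\<bar> \<le> huber (l * r j) / l"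
        using inverse_sqrt_defect(3)[of "l * r j"] l unfolding s_def[symmetric] by (simp add: abs_mult)
      from mult_left_mono[OF this m_nonneg[OF j]]
      show "\<bar>m j * (r j * (1 - 1 / s j))\<bar> \<le> m j * huber (l * r j) / l"
        using m_nonneg[OF j] by (simp add: abs_mult)
    qed
    finally show ?thesis by (simp add: energy_def sum_divide_distrib)
  qed
  have Im_a: "Im a = l * Re b"
    unfolding a_def b_def Im_sum Re_sum sum_distrib_left by (simp add: u_def mult_ac)
  have Re_a: "\<bar>Re a - 1\<bar> \<le> energy l"
  proof -
    have "1 - Re a = (\<Sum>j\<in>J. m j) - Re a" by (simp add: sum_m)
    also have "\<dots> = (\<Sum>j\<in>J. m j * (1 - 1 / s j))"
      unfolding a_def Re_sum sum_subtractf[symmetric] by (intro sum.cong refl) (simp add: u_def algebra_simps)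
    finally have eq: "1 - Re a = (\<Sum>j\<in>J. m j * (1 - 1 / s j))" .
    have "0 \<le> (\<Sum>j\<in>J. m j * (1 - 1 / s j))"
      using inverse_sqrt_defect(3) m_nonneg unfolding s_def by (intro sum_nonneg mult_nonneg_nonneg) auto
    moreover have "(\<Sum>j\<in>J. m j * (1 - 1 / s j)) \<le> energy l" unfolding energy_def s_def
      by (intro sum_mono mult_left_mono inverse_sqrt_defect(2) m_nonneg)
    ultimately show ?thesis using eq by linarith
  qed
  have bl: "energy l / l \<le> energy l" using l energy_nonneg[of l]
    by (simp add: divide_le_eq mult_le_cancel_left1)
  have near: "norm (a + b - 1) \<le> 4 * energy l" "norm (a - b - 1) \<le> 4 * energy l"
  proof -
    have "\<bar>Im a\<bar> \<le> energy l"
      using mult_left_mono[OF abs_Re_b, of l] l unfolding Im_a by (simp add: abs_mult)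
    hence "norm (a - 1) \<le> 2 * energy l" using Re_a cmod_le[of "a - 1"] by simp
    moreover have "norm b \<le> 2 * energy l"
      using abs_Re_b bl Im_b energy_nonneg[of l] l cmod_le[of b] by simp
    ultimately show "norm (a + b - 1) \<le> 4 * energy l" "norm (a - b - 1) \<le> 4 * energy l"
      using norm_triangle_ineq[of "a - 1" b] norm_triangle_ineq4[of "a - 1" b]
      by (simp_all add: algebra_simps)
  qed
  have mean: "(\<Sum>j\<in>J. of_real (tilt t j) * u j) = a + of_real t * b" for t
    by (simp add: a_def b_def tilt_def sum.distrib sum_distrib_left algebra_simps)
  have unit: "norm (a + of_real t * b) \<le> 1" if "\<bar>t\<bar> \<le> 1" for t
  proof -
    have "norm (a + of_real t * b) \<le> (\<Sum>j\<in>J. tilt t j)"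
      unfolding mean[symmetric]
      using tilt_nonneg[OF _ that] by (intro sum_norm_le) (simp add: norm_mult norm_u)
    thus ?thesis by (simp add: sum_tilt)
  qed
  have diff: "(a + b) ^ n - (a - b) ^ n = 2 * b * (\<Sum>p<n. (a + b) ^ p * (a - b) ^ (n' - p))"
    unfolding Suc diff_power_eq_sum by simp
  define X where "X = real n * energy l / l"
  \<comment> \<open>The deviation of the \<open>n\<close> summands, each close to 1, from \<open>n\<close>.\<close>
  define c where "c = (\<Sum>p<n. (a + b) ^ p * (a - b) ^ (n' - p) - 1)"
  have c: "norm c \<le> real n / 4"
  proof -
    have "norm c \<le> (\<Sum>p<n. 1 / 4)" unfolding c_def
    proof (rule sum_norm_le)
      fix p assume "p \<in> {..<n}"
      hence p: "p + (n' - p) \<le> n" using Suc by auto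
      have "norm ((a + b) ^ p * (a - b) ^ (n' - p) - 1) \<le> real (p + (n' - p)) * (4 * energy l)"
        using unit[of 1] unit[of "-1"] near by (intro norm_power_mult_power_minus_one) auto
      also have "\<dots> \<le> real n * (4 * energy l)"
        using p energy_nonneg[of l] by (intro mult_right_mono) auto
      also have "\<dots> \<le> 1 / 4" using E by simp
      finally show "norm ((a + b) ^ p * (a - b) ^ (n' - p) - 1) \<le> 1 / 4" .
    qed
    thus ?thesis by simp
  qed
  have "(a + b) ^ n - (a - b) ^ n = 2 * (of_nat n * b + b * c)"
    unfolding diff c_def sum_subtractf by (simp add: algebra_simps)
  hence "Im ((a + b) ^ n - (a - b) ^ n) = 2 * X + 2 * Im (b * c)"
    by (simp add: Im_b X_def)
  moreover have "\<bar>Im (b * c)\<bar> \<le> X / 2"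
  proof -
    have "\<bar>Im (b * c)\<bar> \<le> norm b * norm c" by (metis abs_Im_le_cmod norm_mult)
    also have "\<dots> \<le> (2 * energy l / l) * (real n / 4)"
    proof (rule mult_mono)
      have "0 \<le> energy l / l" using energy_nonneg[of l] l by simp
      thus "norm b \<le> 2 * energy l / l" using abs_Re_b Im_b cmod_le[of b] by simp
      thus "0 \<le> 2 * energy l / l" using norm_ge_zero order_trans by blast
    qed (use c in auto)
    finally show ?thesis by (simp add: X_def mult_ac)
  qed
  hence "- X \<le> 2 * Im (b * c)" by linarith
  ultimately have low: "X \<le> Im ((a + b) ^ n - (a - b) ^ n)"
    by linarith
  have expand: "(a + of_real t * b) ^ n = (\<Sum>x\<in>words n J. of_real (\<Prod>i=1..n. tilt t (x i)) * (\<Prod>i=1..n. u (x i)))" for t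
    unfolding mean[symmetric] sum_words_prod[OF finite_J, symmetric] by (simp add: prod.distrib)
  have "Im ((a + b) ^ n - (a - b) ^ n)
      = (\<Sum>x\<in>words n J. ((\<Prod>i=1..n. tilt 1 (x i)) - (\<Prod>i=1..n. tilt (-1) (x i))) * Im (\<Prod>i=1..n. u (x i)))"
    using expand[of 1] expand[of "-1"] by (simp add: Im_sum sum_subtractf left_diff_distrib del: of_real_prod)
  also have "\<dots> \<le> l1_dist n" unfolding l1_dist_def
  proof (rule sum_mono)
    fix x :: "nat \<Rightarrow> 'a"
    have "\<bar>Im (\<Prod>i=1..n. u (x i))\<bar> \<le> 1"
      using abs_Im_le_cmod[of "\<Prod>i=1..n. u (x i)"] by (simp add: norm_u prod_norm[symmetric])
    thus "((\<Prod>i=1..n. tilt 1 (x i)) - (\<Prod>i=1..n. tilt (-1) (x i))) * Im (\<Prod>i=1..n. u (x i))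
        \<le> \<bar>(\<Prod>i=1..n. tilt 1 (x i)) - (\<Prod>i=1..n. tilt (-1) (x i))\<bar>"
      by (rule mult_le_abs)
  qed
  finally show ?thesis using low unfolding X_def by linarith
qed
end

section \<open>The implicit equation and the split cost\<close>

context balanced_tilt
begin

definition stretch :: "real \<Rightarrow> real" where
  "stretch u = (\<Sum>j\<in>J. m j * sqrt (1 + (u * r j)\<^sup>2))"

text \<open>
  The objective minimised in \<open>I\<close>, expressed through \<open>m\<close> and \<open>r\<close>: here \<open>\<bar>P - Q\<bar> = 2 m \<bar>r\<bar>\<close> and
  \<open>(P - Q)\<^sup>2 / (P + Q) = 2 m r\<^sup>2\<close>.
\<close>
definition split_cost :: "nat \<Rightarrow> 'a set \<Rightarrow> real" where
  "split_cost n A = 2 * real n * (\<Sum>j\<in>A. m j * \<bar>r j\<bar>) + sqrt (2 * real n * (\<Sum>j\<in>J - A. m j * (r j)\<^sup>2))"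

lemma energy_stretch: "stretch u - 1 \<le> energy u" "energy u \<le> 2 * (stretch u - 1)"
proof -
  have eq: "stretch u - 1 = (\<Sum>j\<in>J. m j * (sqrt (1 + (u * r j)\<^sup>2) - 1))"
    by (simp add: stretch_def right_diff_distrib sum_subtractf sum_m)
  show "stretch u - 1 \<le> energy u" unfolding eq energy_def
    by (intro sum_mono mult_left_mono huber_sqrt(1) m_nonneg)
  have "energy u \<le> (\<Sum>j\<in>J. m j * (2 * (sqrt (1 + (u * r j)\<^sup>2) - 1)))" unfolding energy_def
    by (intro sum_mono mult_left_mono huber_sqrt(2) m_nonneg)
  thus "energy u \<le> 2 * (stretch u - 1)" unfolding eq sum_distrib_left by (simp add: mult_ac)
qed

lemma energy_at_solution:
  assumes n: "1 \<le> n" and eq: "stretch u = exp (1 / (2 * real n))"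
  shows "1 / 2 \<le> real n * energy u" "real n * energy u \<le> 2"
proof -
  define x where "x = 1 / (2 * real n)"
  have nx: "real n * x = 1 / 2" using n by (simp add: x_def)
  note eq = eq[folded x_def]
  have x: "0 \<le> x" "x \<le> 1 / 2" using n by (auto simp: x_def field_simps)
  have "1 + x \<le> exp x" by (rule exp_ge_add_one_self)
  hence "x \<le> energy u" using energy_stretch(1)[of u] eq by linarith
  hence "real n * x \<le> real n * energy u" by (intro mult_left_mono) auto
  thus "1 / 2 \<le> real n * energy u" by (simp add: nx)
  have "exp x \<le> 1 + x + x\<^sup>2" using x by (intro exp_bound) auto
  moreover have "x\<^sup>2 \<le> x * 1" unfolding power2_eq_square using x by (intro mult_left_mono) auto
  ultimately have "energy u \<le> 4 * x"
    using energy_stretch(2)[of u] eq unfolding right_diff_distrib by linarith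
  hence "real n * energy u \<le> real n * (4 * x)" by (intro mult_left_mono) auto
  thus "real n * energy u \<le> 2" using nx by (simp add: algebra_simps)
qed

lemma ex1_stretch_eq:
  assumes i: "i \<in> J" "m i * r i \<noteq> 0" and c: "1 < c"
  shows "\<exists>!t. 0 < t \<and> stretch (1 / t) = c"
proof -
  have mi: "0 < m i" using m_nonneg[OF i(1)] i(2) by (cases "m i = 0") auto
  have strict: "stretch u < stretch v" if uv: "0 \<le> u" "u < v" for u v
    unfolding stretch_def
  proof (rule sum_strict_mono_ex1[OF finite_J])
    have sq: "u\<^sup>2 < v\<^sup>2" using uv by (intro power_strict_mono) auto
    show "\<forall>j\<in>J. m j * sqrt (1 + (u * r j)\<^sup>2) \<le> m j * sqrt (1 + (v * r j)\<^sup>2)"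
      using sq by (intro ballI mult_left_mono m_nonneg)
        (auto simp: power_mult_distrib intro!: mult_right_mono)
    have "u\<^sup>2 * (r i)\<^sup>2 < v\<^sup>2 * (r i)\<^sup>2" using sq i(2) by (intro mult_strict_right_mono) auto
    hence "m i * sqrt (1 + (u * r i)\<^sup>2) < m i * sqrt (1 + (v * r i)\<^sup>2)"
      using mi by (intro mult_strict_left_mono) (auto simp: power_mult_distrib)
    thus "\<exists>j\<in>J. m j * sqrt (1 + (u * r j)\<^sup>2) < m j * sqrt (1 + (v * r j)\<^sup>2)" using i(1) by blast
  qed
  define w where "w = m i * \<bar>r i\<bar>"
  define U where "U = c / w"
  have w: "0 < w" using mi i(2) by (auto simp: w_def)
  have U: "0 < U" using c w by (simp add: U_def)
  have "c = U * w" using w by (simp add: U_def)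
  also have "\<dots> = m i * \<bar>U * r i\<bar>" using U by (simp add: w_def abs_mult)
  also have "\<dots> \<le> m i * sqrt (1 + (U * r i)\<^sup>2)" using mi by (intro mult_left_mono abs_le_sqrt) auto
  also have "\<dots> \<le> stretch U" unfolding stretch_def
    using finite_J i(1) m_nonneg by (intro member_le_sum) auto
  finally have "c \<le> stretch U" .
  moreover have "stretch 0 \<le> c" using c by (simp add: stretch_def sum_m)
  moreover have "continuous_on {0..U} stretch" unfolding stretch_def by (intro continuous_intros)
  ultimately obtain u where u: "0 \<le> u" "stretch u = c" using IVT'[of stretch 0 c U] U by auto
  have "u \<noteq> 0" using u c by (auto simp: stretch_def sum_m)
  hence "0 < 1 / u \<and> stretch (1 / (1 / u)) = c" using u by simp
  moreover have "t = 1 / u" if "0 < t \<and> stretch (1 / t) = c" for t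
  proof -
    have "1 / t = u"
      using strict[of "1 / t" u] strict[of u "1 / t"] that u by (cases "1 / t" u rule: linorder_cases) auto
    thus ?thesis by auto
  qed
  ultimately show ?thesis by blast
qed

text \<open>
  With \<open>a\<close> and \<open>sqrt v\<close> the two parts of the cost, \<open>huber y \<le> \<bar>y\<bar>\<close> on \<open>A\<close> and \<open>huber y \<le> y\<^sup>2\<close> elsewhere
  give \<open>1 \<le> a / T + v / T\<^sup>2\<close>, which is impossible when both parts are small compared with \<open>T\<close>.
\<close>
lemma le_split_cost:
  assumes T: "0 < T" and E: "1 / 2 \<le> real n * energy (1 / T)" and A: "A \<subseteq> J"
  shows "T \<le> 2 * split_cost n A"
proof (rule ccontr)
  define a where "a = 2 * real n * (\<Sum>j\<in>A. m j * \<bar>r j\<bar>)"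
  define v where "v = 2 * real n * (\<Sum>j\<in>J - A. m j * (r j)\<^sup>2)"
  assume "\<not> T \<le> 2 * split_cost n A"
  hence less: "a + sqrt v < T / 2" by (simp add: split_cost_def a_def v_def)
  have a: "0 \<le> a" unfolding a_def using A m_nonneg by (intro mult_nonneg_nonneg sum_nonneg) auto
  have v: "0 \<le> v" unfolding v_def using m_nonneg by (intro mult_nonneg_nonneg sum_nonneg) auto
  have "energy (1 / T) = (\<Sum>j\<in>J - A. m j * huber (1 / T * r j)) + (\<Sum>j\<in>A. m j * huber (1 / T * r j))"
    unfolding energy_def by (rule sum.subset_diff[OF A finite_J])
  also have "\<dots> \<le> (\<Sum>j\<in>J - A. m j * (1 / T * r j)\<^sup>2) + (\<Sum>j\<in>A. m j * \<bar>1 / T * r j\<bar>)"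
    using A by (intro add_mono sum_mono mult_left_mono huber_le_square huber_le_abs m_nonneg) auto
  also have "\<dots> = (\<Sum>j\<in>J - A. m j * (r j)\<^sup>2) / T\<^sup>2 + (\<Sum>j\<in>A. m j * \<bar>r j\<bar>) / T"
    using T by (simp add: sum_divide_distrib power_divide abs_mult)
  finally have "2 * real n * energy (1 / T) \<le> 2 * real n * \<dots>" by (intro mult_left_mono) auto
  also have "\<dots> = v / T\<^sup>2 + a / T" by (simp add: a_def v_def distrib_left)
  finally have "1 \<le> (sqrt v / T)\<^sup>2 + a / T" using E v by (simp add: power_divide)
  moreover have "(sqrt v / T)\<^sup>2 \<le> sqrt v / T"
  proof -
    have "sqrt v / T \<le> 1" using less a T by simp
    thus ?thesis unfolding power2_eq_square using v T by (intro mult_left_le_one_le) auto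
  qed
  moreover have "sqrt v / T + a / T < 1 / 2" using less T by (simp add: field_simps)
  ultimately show False by linarith
qed

text \<open>
  The threshold \<open>\<bar>r\<bar> > T\<close> is where \<open>huber (r / T)\<close> changes from quadratic to linear growth, so that
  \<open>huber\<close> is at least half of the relevant bound on each side.
\<close>
lemma split_cost_le:
  assumes T: "0 < T" and E: "real n * energy (1 / T) \<le> 2"
  shows "\<exists>A\<subseteq>J. split_cost n A \<le> 11 * T"
proof (intro exI conjI)
  let ?A = "{j\<in>J. T < \<bar>r j\<bar>}"
  show "?A \<subseteq> J" by auto
  have part: "(\<Sum>j\<in>B. m j * huber (1 / T * r j)) \<le> energy (1 / T)" if "B \<subseteq> J" for B
    unfolding energy_def using that finite_J m_nonneg huber_nonneg
    by (intro sum_mono2 mult_nonneg_nonneg) auto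
  have "(\<Sum>j\<in>?A. m j * \<bar>r j\<bar>) \<le> (\<Sum>j\<in>?A. 2 * T * (m j * huber (1 / T * r j)))"
  proof (rule sum_mono)
    fix j assume j: "j \<in> ?A"
    hence "\<bar>1 / T * r j\<bar> \<le> 2 * huber (1 / T * r j)"
      using T by (intro abs_le_huber) (simp add: abs_mult)
    hence "\<bar>r j\<bar> \<le> 2 * T * huber (1 / T * r j)" using T by (simp add: abs_mult field_simps)
    from mult_left_mono[OF this, of "m j"] show "m j * \<bar>r j\<bar> \<le> 2 * T * (m j * huber (1 / T * r j))"
      using j m_nonneg by (simp add: mult_ac)
  qed
  also have "\<dots> \<le> 2 * T * energy (1 / T)" unfolding sum_distrib_left[symmetric]
    using T by (intro mult_left_mono part) auto
  finally have "2 * real n * (\<Sum>j\<in>?A. m j * \<bar>r j\<bar>) \<le> 2 * real n * (2 * T * energy (1 / T))"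
    by (intro mult_left_mono) auto
  also have "\<dots> = 4 * T * (real n * energy (1 / T))" by simp
  also have "\<dots> \<le> 4 * T * 2" using T E by (intro mult_left_mono) auto
  finally have a: "2 * real n * (\<Sum>j\<in>?A. m j * \<bar>r j\<bar>) \<le> 8 * T" by simp
  have "(\<Sum>j\<in>J - ?A. m j * (r j)\<^sup>2) \<le> (\<Sum>j\<in>J - ?A. 2 * T\<^sup>2 * (m j * huber (1 / T * r j)))"
  proof (rule sum_mono)
    fix j assume j: "j \<in> J - ?A"
    hence "(1 / T * r j)\<^sup>2 \<le> 2 * huber (1 / T * r j)"
      using T by (intro square_le_huber) (auto simp: abs_mult field_simps)
    hence "(r j)\<^sup>2 \<le> 2 * T\<^sup>2 * huber (1 / T * r j)" using T by (simp add: power_divide field_simps)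
    from mult_left_mono[OF this, of "m j"] show "m j * (r j)\<^sup>2 \<le> 2 * T\<^sup>2 * (m j * huber (1 / T * r j))"
      using j m_nonneg by (simp add: mult_ac)
  qed
  also have "\<dots> \<le> 2 * T\<^sup>2 * energy (1 / T)" unfolding sum_distrib_left[symmetric]
    by (intro mult_left_mono part) auto
  finally have "2 * real n * (\<Sum>j\<in>J - ?A. m j * (r j)\<^sup>2) \<le> 2 * real n * (2 * T\<^sup>2 * energy (1 / T))"
    by (intro mult_left_mono) auto
  also have "\<dots> = 4 * T\<^sup>2 * (real n * energy (1 / T))" by simp
  also have "\<dots> \<le> 4 * T\<^sup>2 * 2" using E by (intro mult_left_mono) auto
  also have "\<dots> \<le> (3 * T)\<^sup>2" by (simp add: power_mult_distrib)
  finally have "sqrt (2 * real n * (\<Sum>j\<in>J - ?A. m j * (r j)\<^sup>2)) \<le> 3 * T"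
    using T by (intro real_le_lsqrt) auto
  thus "split_cost n ?A \<le> 11 * T" using a unfolding split_cost_def by linarith
qed

section \<open>Two-sided bounds in terms of the solution\<close>

lemma l1_dist_le_two: "l1_dist n \<le> 2"
proof -
  let ?p = "\<lambda>x. \<Prod>i=1..n. tilt 1 (x i)" and ?q = "\<lambda>x. \<Prod>i=1..n. tilt (-1) (x i)"
  have "l1_dist n \<le> (\<Sum>x\<in>words n J. ?p x + ?q x)" unfolding l1_dist_def
  proof (rule sum_mono)
    fix x assume x: "x \<in> words n J"
    have "0 \<le> ?p x" "0 \<le> ?q x" using tilt_nonneg[OF words_mem[OF x]] by (auto intro!: prod_nonneg)
    thus "\<bar>?p x - ?q x\<bar> \<le> ?p x + ?q x" by linarith
  qed
  also have "\<dots> = 2" unfolding sum.distrib sum_words_tilt by simp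
  finally show ?thesis .
qed

text \<open>
  The two lower bounds meet at \<open>T = 1/32\<close>: below it the Riesz-product test applies, above it
  \<open>n E r\<^sup>2 \<ge> T\<^sup>2 / 2\<close> is bounded below and the Hellinger bound gives a constant.
\<close>
lemma l1_dist_bounds:
  assumes T: "0 < T" and E: "1 / 2 \<le> real n * energy (1 / T)" "real n * energy (1 / T) \<le> 2"
  shows "min 1 T / 4096 \<le> l1_dist n" "l1_dist n \<le> 4 * exp 4 * min 1 T"
proof -
  show "l1_dist n \<le> 4 * exp 4 * min 1 T"
  proof (cases "T < 1")
    case True
    thus ?thesis using l1_dist_upper[of "1 / T" n] T E by simp
  next
    case False
    have "2 \<le> 4 * exp (4::real)" using exp_ge_add_one_self[of "4::real"] by linarith
    thus ?thesis using False l1_dist_le_two[of n] by (simp add: min_def)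
  qed
  show "min 1 T / 4096 \<le> l1_dist n"
  proof (cases "T \<le> 1 / 32")
    case True
    \<comment> \<open>The factor 1/32 turns \<open>n energy (1 / T) \<le> 2\<close> into the smallness condition \<open>16 n energy l \<le> 1\<close>.\<close>
    define l where "l = 1 / 32 * (1 / T)"
    have l: "1 \<le> l" using True T by (simp add: l_def field_simps)
    have "energy l \<le> 1 / 32 * energy (1 / T)" "(1 / 32)\<^sup>2 * energy (1 / T) \<le> energy l"
      unfolding l_def by (rule energy_scale; simp)+
    from mult_left_mono[OF this(1), of "real n"] mult_left_mono[OF this(2), of "real n"]
    have *: "16 * (real n * energy l) \<le> 1" "1 / 2048 \<le> real n * energy l"
      using E by (simp_all add: power2_eq_square)
    have "1 / 2048 * (1 / l) \<le> real n * energy l * (1 / l)"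
      using *(2) l by (intro mult_right_mono) auto
    also have "\<dots> \<le> l1_dist n" using l1_dist_lower_riesz[OF l *(1)] by simp
    finally show ?thesis using T by (simp add: l_def)
  next
    case False
    define v where "v = real n * (\<Sum>j\<in>J. m j * (r j)\<^sup>2)"
    have "energy (1 / T) \<le> (\<Sum>j\<in>J. m j * (1 / T * r j)\<^sup>2)"
      unfolding energy_def by (intro sum_mono mult_left_mono huber_le_square m_nonneg)
    also have "\<dots> = (\<Sum>j\<in>J. m j * (r j)\<^sup>2) / T\<^sup>2" by (simp add: sum_divide_distrib power_divide)
    finally have "real n * energy (1 / T) \<le> real n * ((\<Sum>j\<in>J. m j * (r j)\<^sup>2) / T\<^sup>2)"
      by (rule mult_left_mono) simp
    hence "1 / 2 \<le> v / T\<^sup>2" unfolding v_def times_divide_eq_right using E(1) by (rule order_trans[rotated])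
    hence "T\<^sup>2 / 2 \<le> v" using T by (simp add: field_simps)
    moreover have "(1 / 32)\<^sup>2 \<le> T\<^sup>2" using False by (intro power_mono) auto
    ultimately have v: "1 / 2048 \<le> v" by (simp add: power2_eq_square)
    have "exp (- v / 2) \<le> exp (- 1 / 4096)" using v by simp
    also have "exp (- 1 / 4096) \<le> (4096 / 4097 :: real)"
      using exp_ge_add_one_self[of "1 / 4096 :: real"] by (simp add: exp_minus field_simps)
    finally have "1 / 4096 \<le> 2 * (1 - exp (- v / 2))" by simp
    also have "\<dots> \<le> l1_dist n" using l1_dist_lower_hellinger[of n] by (simp add: v_def)
    finally show ?thesis by (rule order_trans[rotated]) simp
  qed
qed
end

section \<open>Total variation of product laws and of histograms\<close>

lemma TV_eqI:
  assumes "\<And>B. B \<in> sets \<mu> \<Longrightarrow> \<bar>measure \<mu> B - measure \<nu> B\<bar> \<le> d"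
    and "B \<in> sets \<mu>" "\<bar>measure \<mu> B - measure \<nu> B\<bar> = d"
  shows "TV \<mu> \<nu> = d"
  unfolding TV_def using assms by (intro cSup_eq_maximum) auto

lemma sets_prod_law:
  assumes "prob_on k P"
  shows "sets (prod_law n P) = Pow (words n {1..k})" "space (prod_law n P) = words n {1..k}"
proof -
  have P: "sets P = sets (count_space {1..k})" using assms by (simp add: prob_on_def)
  hence "sets (prod_law n P) = sets (\<Pi>\<^sub>M i\<in>{1..n}. count_space {1..k})"
    unfolding prod_law_def by (intro sets_PiM_cong) auto
  thus sets: "sets (prod_law n P) = Pow (words n {1..k})"
    by (simp add: count_space_PiM_finite words_def)
  hence "sets (prod_law n P) = sets (count_space (words n {1..k}))" by simp
  from sets_eq_imp_space_eq[OF this] show "space (prod_law n P) = words n {1..k}" by simp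
qed

lemma finite_words_atLeastAtMost: "finite (words n {1..k::nat})"
  unfolding words_def by (intro finite_PiE) auto

lemma measure_prod_law:
  assumes P: "prob_on k P" and B: "B \<subseteq> words n {1..k}"
  shows "measure (prod_law n P) B = (\<Sum>x\<in>B. \<Prod>i=1..n. mass P (x i))"
proof -
  interpret P: prob_space P using P by (simp add: prob_on_def)
  interpret F: finite_product_prob_space "\<lambda>_. P" "{1..n}" by unfold_locales auto
  have sets: "{x} \<in> sets (prod_law n P)" if "x \<in> B" for x
    using that B unfolding sets_prod_law[OF P] by auto
  have "measure (prod_law n P) B = (\<Sum>x\<in>B. measure (prod_law n P) {x})"
    unfolding prod_law_def using finite_subset[OF B finite_words_atLeastAtMost] sets[unfolded prod_law_def]
    by (rule F.finite_measure_eq_sum_singleton)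
  also have "\<dots> = (\<Sum>x\<in>B. \<Prod>i=1..n. mass P (x i))"
  proof (rule sum.cong[OF refl])
    fix x assume "x \<in> B"
    hence x: "x \<in> {1..n} \<rightarrow>\<^sub>E {1..k}" using B by (auto simp: words_def)
    hence "{x} = (\<Pi>\<^sub>E i\<in>{1..n}. {x i})" by (simp add: PiE_singleton PiE_iff)
    moreover have "measure (prod_law n P) (\<Pi>\<^sub>E i\<in>{1..n}. {x i}) = (\<Prod>i=1..n. measure P {x i})"
      unfolding prod_law_def using x P
      by (intro F.finite_measure_PiM_emb) (auto simp: prob_on_def)
    ultimately show "measure (prod_law n P) {x} = (\<Prod>i=1..n. mass P (x i))" by (simp add: mass_def)
  qed
  finally show ?thesis .
qed

lemma sum_subset_le_half_abs:
  fixes f :: "'a \<Rightarrow> real"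
  assumes "finite S" "B \<subseteq> S" "(\<Sum>x\<in>S. f x) = 0"
  shows "\<bar>\<Sum>x\<in>B. f x\<bar> \<le> (\<Sum>x\<in>S. \<bar>f x\<bar>) / 2"
proof -
  have "(\<Sum>x\<in>S. \<bar>f x\<bar>) = (\<Sum>x\<in>S - B. \<bar>f x\<bar>) + (\<Sum>x\<in>B. \<bar>f x\<bar>)"
    "(\<Sum>x\<in>S. f x) = (\<Sum>x\<in>S - B. f x) + (\<Sum>x\<in>B. f x)"
    by (rule sum.subset_diff[OF assms(2,1)])+
  thus ?thesis using sum_abs[of f "S - B"] sum_abs[of f B] assms(3) by linarith
qed

lemma sum_positive_part_eq_half_abs:
  fixes f :: "'a \<Rightarrow> real"
  assumes "finite S" "(\<Sum>x\<in>S. f x) = 0"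
  shows "(\<Sum>x\<in>{x\<in>S. 0 \<le> f x}. f x) = (\<Sum>x\<in>S. \<bar>f x\<bar>) / 2"
proof -
  have "(\<Sum>x\<in>{x\<in>S. 0 \<le> f x}. f x) = (\<Sum>x\<in>S. (\<bar>f x\<bar> + f x) / 2)"
    using assms(1) by (subst sum.inter_filter) (auto intro!: sum.cong)
  thus ?thesis by (simp add: sum_divide_distrib[symmetric] sum.distrib assms(2))
qed

lemma mass_nonneg: "0 \<le> mass R j"
  by (simp add: mass_def)

lemma sum_mass: "prob_on k P \<Longrightarrow> (\<Sum>j=1..k. mass P j) = 1"
proof -
  assume P: "prob_on k P"
  then interpret P: prob_space P by (simp add: prob_on_def)
  have sets: "sets P = Pow {1..k}" using P by (simp add: prob_on_def)
  hence "sets P = sets (count_space {1..k})" by simp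
  from sets_eq_imp_space_eq[OF this] have "space P = {1..k}" by simp
  moreover have "measure P {1..k} = (\<Sum>j=1..k. measure P {j})"
    using sets by (intro P.finite_measure_eq_sum_singleton) auto
  ultimately show ?thesis using P.prob_space by (simp add: mass_def)
qed

lemma prod_mass_histogram:
  assumes "x \<in> words n {1..k}"
  shows "(\<Prod>i=1..n. mass P (x i)) = (\<Prod>j=1..k. mass P j ^ histogram n k x j)"
proof -
  have "(\<Prod>i=1..n. mass P (x i)) = (\<Prod>j=1..k. \<Prod>i\<in>{i\<in>{1..n}. x i = j}. mass P (x i))"
    using assms by (intro prod.group[symmetric]) (auto simp: words_def)
  also have "\<dots> = (\<Prod>j=1..k. mass P j ^ histogram n k x j)"
    by (intro prod.cong refl) (simp add: histogram_def)
  finally show ?thesis .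
qed

context
  fixes k :: nat and P Q :: "nat measure"
  assumes P: "prob_on k P" and Q: "prob_on k Q"
begin

text \<open>
  The histogram is a sufficient statistic: by \<open>prod_mass_histogram\<close> the sign of the difference \<open>f\<close> of
  the word masses is a function of the histogram. Hence the optimal set \<open>{f \<ge> 0}\<close> is the full
  preimage of its image, and the pushed-forward laws are separated just as well on that image.
\<close>
lemma TV_prod_law_and_Mult:
  defines "d \<equiv> \<lambda>n. (\<Sum>x\<in>words n {1..k}. \<bar>(\<Prod>i=1..n. mass P (x i)) - (\<Prod>i=1..n. mass Q (x i))\<bar>) / 2"
  shows "TV (prod_law n P) (prod_law n Q) = d n" "TV (Mult n k P) (Mult n k Q) = d n"
proof -
  define f where "f x = (\<Prod>i=1..n. mass P (x i)) - (\<Prod>i=1..n. mass Q (x i))" for x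
  let ?W = "words n {1..k}"
  let ?B = "{x\<in>?W. 0 \<le> f x}"
  have diff: "measure (prod_law n P) B - measure (prod_law n Q) B = (\<Sum>x\<in>B. f x)" if "B \<subseteq> ?W" for B
    using that by (simp only: measure_prod_law[OF P] measure_prod_law[OF Q] f_def sum_subtractf)
  have f0: "(\<Sum>x\<in>?W. f x) = 0" unfolding f_def sum_subtractf
    by (simp only: sum_words_prod[OF finite_atLeastAtMost] sum_mass[OF P] sum_mass[OF Q] diff_self)
  have le: "\<bar>measure (prod_law n P) B - measure (prod_law n Q) B\<bar> \<le> d n" if "B \<subseteq> ?W" for B
    using sum_subset_le_half_abs[OF finite_words_atLeastAtMost that f0] diff[OF that] by (simp add: d_def f_def)
  have "0 \<le> (\<Sum>x\<in>?B. f x)" by (intro sum_nonneg) auto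
  hence eq: "\<bar>measure (prod_law n P) ?B - measure (prod_law n Q) ?B\<bar> = d n"
    using sum_positive_part_eq_half_abs[OF finite_words_atLeastAtMost f0] diff[of ?B] by (simp add: d_def f_def)
  show "TV (prod_law n P) (prod_law n Q) = d n"
    by (rule TV_eqI[OF _ _ eq]) (auto simp: sets_prod_law[OF P] intro!: le)
  let ?h = "histogram n k" and ?Z = "{1..k} \<rightarrow>\<^sub>E (UNIV :: nat set)"
  have sets: "sets (Mult n k P) = Pow ?Z" by (simp add: Mult_def)
  have Mult: "measure (Mult n k R) B = measure (prod_law n R) (?h -` B \<inter> ?W)"
    if R: "prob_on k R" and B: "B \<in> Pow ?Z" for R B
    unfolding Mult_def sets_prod_law(2)[OF R, symmetric]
    by (rule measure_distr[OF measurable_histogram[OF R]]) (use B in simp)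
  have pull: "?h -` (?h ` ?B) \<inter> ?W = ?B"
  proof
    show "?h -` (?h ` ?B) \<inter> ?W \<subseteq> ?B"
    proof
      fix x assume x: "x \<in> ?h -` (?h ` ?B) \<inter> ?W"
      then obtain y where y: "y \<in> ?B" "?h x = ?h y" by auto
      hence "f x = f y" using x by (simp add: f_def prod_mass_histogram[of _ n k, simplified])
      thus "x \<in> ?B" using x y by auto
    qed
  qed auto
  show "TV (Mult n k P) (Mult n k Q) = d n"
  proof (rule TV_eqI[where B = "?h ` ?B"])
    show "\<bar>measure (Mult n k P) B - measure (Mult n k Q) B\<bar> \<le> d n" if "B \<in> sets (Mult n k P)" for B
      using that unfolding sets by (simp only: Mult[OF P] Mult[OF Q]) (intro le, auto)
    have img: "?h ` ?B \<in> Pow ?Z" by (auto simp: histogram_def)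
    thus "?h ` ?B \<in> sets (Mult n k P)" by (simp only: sets)
    show "\<bar>measure (Mult n k P) (?h ` ?B) - measure (Mult n k Q) (?h ` ?B)\<bar> = d n"
      unfolding Mult[OF P img] Mult[OF Q img] pull by (rule eq)
  qed
qed

section \<open>Reduction of two measures to opposite tilts\<close>

definition avg :: "nat \<Rightarrow> real" where
  "avg j = (mass P j + mass Q j) / 2"

text \<open>Where both masses vanish, \<open>skew\<close> is 0, which is harmless because \<open>avg\<close> vanishes there too.\<close>
definition skew :: "nat \<Rightarrow> real" where
  "skew j = (mass P j - mass Q j) / (mass P j + mass Q j)"

lemma two_avg: "2 * avg j = mass P j + mass Q j"
  by (simp only: avg_def) simp

lemma two_avg_skew: "2 * (avg j * skew j) = mass P j - mass Q j"
proof (cases "mass P j + mass Q j = 0")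
  case True
  hence "mass P j = 0" "mass Q j = 0" using mass_nonneg[of P j] mass_nonneg[of Q j] by linarith+
  thus ?thesis by (simp add: avg_def)
next
  case False
  have "2 * (avg j * skew j) = (2 * avg j) * skew j" by simp
  also have "\<dots> = mass P j - mass Q j"
    unfolding two_avg skew_def by (rule nonzero_mult_div_cancel_left[OF False, folded times_divide_eq_right])
  finally show ?thesis .
qed

interpretation balanced_tilt "{1..k}" avg skew
proof
  show "0 \<le> avg j" for j using mass_nonneg[of P j] mass_nonneg[of Q j] by (simp add: avg_def)
  show "(\<Sum>j=1..k. avg j) = 1"
    unfolding avg_def sum_divide_distrib[symmetric] sum.distrib sum_mass[OF P] sum_mass[OF Q] by simp
  have "2 * (\<Sum>j=1..k. avg j * skew j) = 0"
    unfolding sum_distrib_left two_avg_skew sum_subtractf sum_mass[OF P] sum_mass[OF Q] by simp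
  thus "(\<Sum>j=1..k. avg j * skew j) = 0" by simp
  show "\<bar>skew j\<bar> \<le> 1" for j
  proof -
    have "\<bar>mass P j - mass Q j\<bar> \<le> \<bar>mass P j + mass Q j\<bar>"
      using mass_nonneg[of P j] mass_nonneg[of Q j] by linarith
    hence "\<bar>skew j\<bar> \<le> \<bar>mass P j + mass Q j\<bar> / \<bar>mass P j + mass Q j\<bar>"
      unfolding skew_def abs_divide by (rule divide_right_mono) simp
    also have "\<dots> \<le> 1" by (cases "mass P j + mass Q j = 0") auto
    finally show ?thesis .
  qed
qed auto

lemma tilt_eq_mass: "tilt 1 j = mass P j" "tilt (-1) j = mass Q j"
  using two_avg[of j] two_avg_skew[of j] by (simp_all add: tilt_def algebra_simps)

lemma TV_eq_l1_dist: "TV (prod_law n P) (prod_law n Q) = l1_dist n / 2" "TV (Mult n k P) (Mult n k Q) = l1_dist n / 2"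
  unfolding TV_prod_law_and_Mult l1_dist_def tilt_eq_mass by (rule refl)+

lemma solves_T_iff: "solves_T n k P Q t \<longleftrightarrow> 0 < t \<and> stretch (1 / t) = exp (1 / (2 * real n))"
proof -
  have "1 / 2 * sqrt ((mass P j + mass Q j)\<^sup>2 + (mass P j - mass Q j)\<^sup>2 / t\<^sup>2)
      = avg j * sqrt (1 + (1 / t * skew j)\<^sup>2)" for j
  proof -
    have "(mass P j + mass Q j)\<^sup>2 + (mass P j - mass Q j)\<^sup>2 / t\<^sup>2
        = (2 * avg j)\<^sup>2 + (2 * (avg j * skew j))\<^sup>2 / t\<^sup>2"
      unfolding two_avg two_avg_skew ..
    also have "\<dots> = (2 * avg j)\<^sup>2 * (1 + (1 / t * skew j)\<^sup>2)"
      by (simp add: power_mult_distrib power_divide algebra_simps)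
    finally show ?thesis using mass_nonneg[of P j] mass_nonneg[of Q j]
      by (simp add: real_sqrt_mult avg_def)
  qed
  thus ?thesis by (simp add: solves_T_def stretch_def sum_distrib_left del: One_nat_def)
qed

lemma I_val_eq: "I_val n k P Q = Min (split_cost n ` Pow {1..k})"
proof -
  have "real n * (\<Sum>j\<in>A. \<bar>mass P j - mass Q j\<bar>)
      + sqrt (real n * (\<Sum>j\<in>{1..k} - A. (mass P j - mass Q j)\<^sup>2 / (mass P j + mass Q j))) = split_cost n A" for A
  proof -
    have "\<bar>mass P j - mass Q j\<bar> = 2 * (avg j * \<bar>skew j\<bar>)" for j
      unfolding two_avg_skew[symmetric]
      using mass_nonneg[of P j] mass_nonneg[of Q j] by (simp add: abs_mult avg_def)
    moreover have "(mass P j - mass Q j)\<^sup>2 / (mass P j + mass Q j) = 2 * (avg j * (skew j)\<^sup>2)" for j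
    proof -
      have "2 * (avg j * (skew j)\<^sup>2) = (2 * (avg j * skew j)) * skew j" by (simp add: power2_eq_square)
      thus ?thesis unfolding two_avg_skew by (simp add: skew_def power2_eq_square)
    qed
    ultimately show ?thesis by (simp add: split_cost_def sum_distrib_left[symmetric] mult_ac del: One_nat_def)
  qed
  thus ?thesis by (simp add: I_val_def)
qed

lemma ex1_solves_T:
  assumes "P \<noteq> Q" "1 \<le> n"
  shows "\<exists>!t. solves_T n k P Q t"
proof -
  interpret P: prob_space P using P by (simp add: prob_on_def)
  interpret Q: prob_space Q using Q by (simp add: prob_on_def)
  have "\<exists>j\<in>{1..k}. mass P j \<noteq> mass Q j"
  proof (rule ccontr)
    assume "\<not> ?thesis"
    hence "P = Q" using P Q
      by (intro measure_eqI_finite[of _ "{1..k}"])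
        (auto simp: prob_on_def mass_def P.emeasure_eq_measure Q.emeasure_eq_measure)
    with \<open>P \<noteq> Q\<close> show False ..
  qed
  then obtain j where "j \<in> {1..k}" "mass P j \<noteq> mass Q j" by blast
  moreover from this have "avg j * skew j \<noteq> 0" using two_avg_skew[of j] by auto
  ultimately show ?thesis unfolding solves_T_iff using assms(2) by (intro ex1_stretch_eq) auto
qed

lemma distinct_bounds:
  assumes "P \<noteq> Q" "1 \<le> n"
  shows "min 1 (T_val n k P Q) / 8192 \<le> TV (Mult n k P) (Mult n k Q)"
    and "TV (Mult n k P) (Mult n k Q) \<le> 2 * exp 4 * min 1 (T_val n k P Q)"
    and "I_val n k P Q \<le> 11 * T_val n k P Q"
    and "T_val n k P Q \<le> 2 * I_val n k P Q"
proof -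
  let ?T = "T_val n k P Q"
  have "solves_T n k P Q ?T"
    using theI'[OF ex1_solves_T[OF assms]] assms(1) by (simp add: T_val_def)
  hence T: "0 < ?T" "stretch (1 / ?T) = exp (1 / (2 * real n))" by (auto simp: solves_T_iff)
  note E = energy_at_solution[OF assms(2) T(2)]
  show "min 1 ?T / 8192 \<le> TV (Mult n k P) (Mult n k Q)"
    "TV (Mult n k P) (Mult n k Q) \<le> 2 * exp 4 * min 1 ?T"
    using l1_dist_bounds[OF T(1) E] unfolding TV_eq_l1_dist by simp_all
  have fin: "finite (split_cost n ` Pow {1..k})" "split_cost n ` Pow {1..k} \<noteq> {}" by auto
  from split_cost_le[OF T(1) E(2)] show "I_val n k P Q \<le> 11 * ?T"
    unfolding I_val_eq Min_le_iff[OF fin] by auto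
  have "I_val n k P Q \<in> split_cost n ` Pow {1..k}" unfolding I_val_eq by (rule Min_in[OF fin])
  thus "?T \<le> 2 * I_val n k P Q" using le_split_cost[OF T(1) E(1)] by auto
qed
end

lemma identical_laws:
  assumes "prob_on k P"
  shows "TV (Mult n k P) (Mult n k P) = 0" "T_val n k P P = 0" "I_val n k P P = 0"
proof -
  show "TV (Mult n k P) (Mult n k P) = 0" unfolding TV_prod_law_and_Mult(2)[OF assms assms] by simp
  show "T_val n k P P = 0" by (simp add: T_val_def)
  have "(\<lambda>_. 0) ` Pow {1..k} = {0::real}" by auto
  thus "I_val n k P P = 0" by (simp add: I_val_def)
qed

section \<open>The theorem\<close>

theorem mainTheorem5:
  shows "\<exists>c C :: real. 0 < c \<and> c \<le> C \<and>
    (\<forall>(n::nat) (k::nat) (P :: nat measure) (Q :: nat measure).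
       n \<ge> 1 \<longrightarrow> k \<ge> 1 \<longrightarrow> prob_on k P \<longrightarrow> prob_on k Q \<longrightarrow>
       (P \<noteq> Q \<longrightarrow> (\<exists>!t. solves_T n k P Q t)) \<and>
       (let T = T_val n k P Q; I = I_val n k P Q; tv = TV (Mult n k P) (Mult n k Q) in
          tv = TV (prod_law n P) (prod_law n Q) \<and>
          c * min 1 T \<le> tv \<and> tv \<le> C * min 1 T \<and>
          c * I \<le> T \<and> T \<le> C * I))"
proof (intro exI conjI allI impI)
  let ?c = "1 / 8192 :: real" and ?C = "2 * exp 4 :: real"
  show "0 < ?c" by simp
  have C: "2 \<le> ?C" using exp_ge_add_one_self[of "4::real"] by simp
  thus "?c \<le> ?C" by linarith
  fix n k :: nat and P Q :: "nat measure"
  assume n: "1 \<le> n" and P: "prob_on k P" and Q: "prob_on k Q"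
  show "\<exists>!t. solves_T n k P Q t" if "P \<noteq> Q" by (rule ex1_solves_T[OF P Q that n])
  show "let T = T_val n k P Q; I = I_val n k P Q; tv = TV (Mult n k P) (Mult n k Q) in
          tv = TV (prod_law n P) (prod_law n Q) \<and>
          ?c * min 1 T \<le> tv \<and> tv \<le> ?C * min 1 T \<and> ?c * I \<le> T \<and> T \<le> ?C * I"
  proof (cases "P = Q")
    case True
    thus ?thesis using identical_laws[OF P, of n] TV_prod_law_and_Mult[OF P P, of n] by (simp add: Let_def)
  next
    case False
    note bounds = distinct_bounds[OF P Q False n]
    have T: "0 \<le> T_val n k P Q" and I: "0 \<le> I_val n k P Q" using bounds(3,4) by linarith+
    have "2 * I_val n k P Q \<le> ?C * I_val n k P Q" using C I by (rule mult_right_mono)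
    moreover have "?c * I_val n k P Q \<le> T_val n k P Q" using bounds(3) T by simp
    ultimately show ?thesis using bounds
      by (simp add: Let_def TV_prod_law_and_Mult[OF P Q])
  qed
qed

end
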